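(* Let $G$ be a (finite or infinite) group, let $A\subseteq G$, and let $u,v\in G$. Then $u$ and $v$ are in the same left coset of $\langle A\rangle$ in $G$ if and only if $u\,\mathfrak{p}\,v$, where $\mathfrak{p}$ is the equivalence relation on $G$ induced by the Cayley graph $\mathrm{Cay}(G,A)$.
   Context: $\langle A\rangle$ denotes the subgroup of $G$ generated by $A$. The (undirected) Cayley graph $\mathrm{Cay}(G,A)$, for an arbitrary subset $A$ of a group $G$ with identity $e$, is the graph with vertex set $G$ in which $\{u,v\}$ is an edge if and only if $u=va$ or $v=ua$ for some $a\in A\setminus\{e\}$. For a graph with vertex set $V$, the equivalence relation $\mathfrak{p}$ on $V$ induced by the graph is: $u\,\mathfrak{p}\,v$ if and only if $u=v$ or there is a path from $u$ to $v$. Left cosets are sets of the form $g\langle A\rangle$, $g\in G$. *)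

theory Defs
  imports "HOL-Algebra.Left_Coset" "HOL-Algebra.Generated_Groups" "Graph_Theory.Graph_Theory"
begin

text \<open>Undirected graphs are rendered in the convention of the Graph_Theory entry: an edge
  \<open>{u, v}\<close> is the pair of opposite arcs \<open>(u, v)\<close> and \<open>(v, u)\<close>.\<close>

definition Cay :: "('a, 'b) monoid_scheme \<Rightarrow> 'a set \<Rightarrow> 'a pair_pre_digraph" where
  "Cay G A = \<lparr> pverts = carrier G,
     parcs = {(u, v). u \<in> carrier G \<and> v \<in> carrier G \<and>
                (\<exists>a \<in> A - {\<one>\<^bsub>G\<^esub>}. u = v \<otimes>\<^bsub>G\<^esub> a \<or> v = u \<otimes>\<^bsub>G\<^esub> a)} \<rparr>"

lemma (in group) Cay_undirected:
  assumes "A \<subseteq> carrier G"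
  shows "sym_digraph (with_proj (Cay G A))" "loopfree_digraph (with_proj (Cay G A))"
    "nomulti_digraph (with_proj (Cay G A))"
proof -
  show *: "sym_digraph (with_proj (Cay G A))"
    by unfold_locales
      (auto simp: Cay_def symmetric_def arcs_ends_def arc_to_ends_def sym_def)
  show "loopfree_digraph (with_proj (Cay G A))"
    using assms by unfold_locales (auto simp: Cay_def)
  show "nomulti_digraph (with_proj (Cay G A))"
    by unfold_locales (auto simp: Cay_def arc_to_ends_def)
qed

text \<open>\<open>apath\<close> requires pairwise distinct vertices; it also admits the empty path from a vertex
  to itself, which agrees with the disjunct \<open>u = v\<close>.\<close>

definition path_rel :: "('a, 'b) pre_digraph \<Rightarrow> 'a rel" where
  "path_rel \<Gamma> = {(u, v). u \<in> verts \<Gamma> \<and> v \<in> verts \<Gamma> \<and>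
     (u = v \<or> (\<exists>p. pre_digraph.apath \<Gamma> u p v))}"

lemma (in sym_digraph) equiv_path_rel: "equiv (verts G) (path_rel G)"
proof -
  have *: "path_rel G = {(u, v). u \<rightarrow>\<^sup>*\<^bsub>G\<^esub> v}"
    unfolding path_rel_def
    by (auto simp: reachable_refl reachable_in_verts simp flip: reachable_apath)
  show ?thesis
    unfolding * equiv_def refl_on_def sym_def trans_def
    by (auto intro: reachable_trans symmetric_reachable[OF sym_arcs] dest: reachable_in_verts)
qed

end

theory Submission
  imports Defs
begin

text \<open>Both sides say that \<open>inv u \<otimes> v\<close> lies in the subgroup generated by
  \<open>A\<close>. For cosets this is the usual criterion (\<open>mem_common_lcoset_iff\<close>).
  In the graph, crossing an edge is right multiplication by a nontrivial element of \<open>A\<close>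
  or by the inverse of one, so a walk starting at u spells a word h in these elements and ends at
  \<open>u \<otimes> h\<close>; conversely every such word can be walked from any vertex
  (\<open>Cay_reachable_iff\<close>). Walks compose and so suit induction, whereas paths with
  distinct vertices do not; \<open>path_rel_iff_reachable\<close> passes from one to the
  other.\<close>

lemma (in sym_digraph) path_rel_iff_reachable: "(u, v) \<in> path_rel G \<longleftrightarrow> u \<rightarrow>\<^sup>*\<^bsub>G\<^esub> v"
  unfolding path_rel_def
  by (auto simp: reachable_refl reachable_in_verts simp flip: reachable_apath)

lemma pverts_Cay [simp]: "pverts (Cay G A) = carrier G"
  by (simp add: Cay_def)

lemma parcs_Cay_iff:
  "(x, y) \<in> parcs (Cay G A) \<longleftrightarrow> x \<in> carrier G \<and> y \<in> carrier G \<and>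
     (\<exists>a \<in> A - {\<one>\<^bsub>G\<^esub>}. x = y \<otimes>\<^bsub>G\<^esub> a \<or> y = x \<otimes>\<^bsub>G\<^esub> a)"
  by (simp add: Cay_def)

context group
begin

text \<open>A common representative g cancels in
  \<open>inv (g \<otimes> h) \<otimes> (g \<otimes> k)\<close>. Conversely, the coset of u itself
  contains both elements.\<close>

lemma mem_common_lcoset_iff:
  assumes "subgroup H G" "u \<in> carrier G" "v \<in> carrier G"
  shows "(\<exists>C \<in> lcosets H. u \<in> C \<and> v \<in> C) \<longleftrightarrow> inv u \<otimes> v \<in> H"
proof
  assume "\<exists>C \<in> lcosets H. u \<in> C \<and> v \<in> C"
  then obtain g h k where g: "g \<in> carrier G" "h \<in> H" "k \<in> H" "u = g \<otimes> h" "v = g \<otimes> k"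
    by (auto simp: LCOSETS_def l_coset_def)
  then have "h \<in> carrier G" "k \<in> carrier G"
    using assms(1) subgroup.mem_carrier by metis+
  with g have "inv u \<otimes> v = inv h \<otimes> k"
    by (simp add: inv_mult_group m_assoc inv_solve_left')
  with g assms(1) show "inv u \<otimes> v \<in> H"
    by (simp add: subgroup.m_closed subgroup.m_inv_closed)
next
  assume H: "inv u \<otimes> v \<in> H"
  have "u \<in> u <# H"
    using assms subgroup.one_closed[OF assms(1)] by (force simp: l_coset_def)
  moreover have "v = u \<otimes> (inv u \<otimes> v)"
    using assms by (simp flip: m_assoc)
  then have "v \<in> u <# H"
    using H by (auto simp: l_coset_def)
  moreover have "u <# H \<in> lcosets H"
    using assms by (auto simp: LCOSETS_def)
  ultimately show "\<exists>C \<in> lcosets H. u \<in> C \<and> v \<in> C"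
    by blast
qed

text \<open>The induction follows the way h is generated. The start x must stay arbitrary: for a
  product \<open>h \<otimes> k\<close>, the walk for k begins at
  \<open>x \<otimes> h\<close>.\<close>

lemma Cay_reachable_mult_generate:
  assumes A: "A \<subseteq> carrier G" and "h \<in> generate G A" "x \<in> carrier G"
  shows "x \<rightarrow>\<^sup>*\<^bsub>with_proj (Cay G A)\<^esub> (x \<otimes> h)"
proof -
  interpret Cay: sym_digraph "with_proj (Cay G A)"
    using Cay_undirected(1)[OF A] .
  show ?thesis
    using assms(2,3)
  proof (induction arbitrary: x)
    case one
    then show ?case by (simp add: Cay.reachable_refl)
  next
    case (incl a)
    then show ?case
    \<comment> \<open>The graph has no loops, so the identity yields no edge; the walk then stays at
      x.\<close>
    proof (cases "a = \<one>")
      case False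
      then have "x \<rightarrow>\<^bsub>with_proj (Cay G A)\<^esub> (x \<otimes> a)"
        using incl A by (auto simp: parcs_Cay_iff)
      then show ?thesis by (rule Cay.reachable_adjI)
    qed (simp add: Cay.reachable_refl)
  next
    case (inv a)
    have a: "a \<in> carrier G" using inv A by blast
    show ?case
    proof (cases "a = \<one>")
      case False
      \<comment> \<open>An inverse needs no edge of its own: it is the edge for a, crossed backwards
        from its other end \<open>x \<otimes> inv a\<close>.\<close>
      have "x = x \<otimes> inv a \<otimes> a" using a inv by (simp add: m_assoc)
      then have "x \<rightarrow>\<^bsub>with_proj (Cay G A)\<^esub> (x \<otimes> inv a)"
        using inv a False by (auto simp: parcs_Cay_iff)
      then show ?thesis by (rule Cay.reachable_adjI)
    qed (use inv in \<open>simp add: Cay.reachable_refl\<close>)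
  next
    case (eng h k)
    then have "h \<in> carrier G" "k \<in> carrier G"
      using generate_in_carrier[OF A] by auto
    then show ?case
      using eng.IH(1)[of x] eng.IH(2)[of "x \<otimes> h"] eng.prems
      by (auto simp: m_assoc intro: Cay.reachable_trans)
  qed
qed

text \<open>Along the walk the quotients telescope: \<open>inv x \<otimes> z\<close> is
  \<open>inv x \<otimes> y\<close> times \<open>inv y \<otimes> z\<close>, and for the last edge the
  second factor is a generator or the inverse of one.\<close>

lemma Cay_reachable_imp_generate:
  assumes A: "A \<subseteq> carrier G" and "x \<rightarrow>\<^sup>*\<^bsub>with_proj (Cay G A)\<^esub> y"
  shows "inv x \<otimes> y \<in> generate G A"
proof -
  interpret Cay: sym_digraph "with_proj (Cay G A)"
    using Cay_undirected(1)[OF A] .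
  show ?thesis
    using assms(2)
  proof (induction rule: Cay.reachable_induct)
    case base
    then show ?case by (simp add: generate.one)
  next
    case (step y z)
    then have "x \<in> carrier G"
      using Cay.reachable_in_verts(1) by fastforce
    moreover from step obtain a where yz: "y \<in> carrier G" "z \<in> carrier G"
      and a: "a \<in> A" "y = z \<otimes> a \<or> z = y \<otimes> a"
      by (auto simp: parcs_Cay_iff)
    \<comment> \<open>The two disjuncts come from the two orientations of the edge:
      \<open>z = y \<otimes> a\<close> gives a, and \<open>y = z \<otimes> a\<close> gives
      \<open>inv a\<close>.\<close>
    moreover have "inv y \<otimes> z = a \<or> inv y \<otimes> z = inv a"
      using a yz A by (auto simp: inv_mult_group m_assoc inv_solve_left')
    then have "inv y \<otimes> z \<in> generate G A"
      using a generate.incl generate.inv by metis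
    moreover have "y \<otimes> (inv y \<otimes> z) = z"
      using yz by (simp flip: m_assoc)
    ultimately show ?case
      using step generate.eng[of "inv x \<otimes> y" G A "inv y \<otimes> z"]
      by (simp add: m_assoc)
  qed
qed

lemma Cay_reachable_iff:
  assumes "A \<subseteq> carrier G" "x \<in> carrier G" "y \<in> carrier G"
  shows "x \<rightarrow>\<^sup>*\<^bsub>with_proj (Cay G A)\<^esub> y \<longleftrightarrow> inv x \<otimes> y \<in> generate G A"
proof
  assume "inv x \<otimes> y \<in> generate G A"
  moreover have "x \<otimes> (inv x \<otimes> y) = y"
    using assms by (simp flip: m_assoc)
  ultimately show "x \<rightarrow>\<^sup>*\<^bsub>with_proj (Cay G A)\<^esub> y"
    using Cay_reachable_mult_generate[of A "inv x \<otimes> y" x] assms by simp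
qed (use Cay_reachable_imp_generate assms in blast)

end

theorem theorem2p4:
  fixes G :: "('a, 'b) monoid_scheme" and A :: "'a set" and u v :: 'a
  assumes "group G" and "A \<subseteq> carrier G" and "u \<in> carrier G" and "v \<in> carrier G"
  shows "(\<exists>C \<in> lcosets\<^bsub>G\<^esub> (generate G A). u \<in> C \<and> v \<in> C)
    \<longleftrightarrow> (u, v) \<in> path_rel (with_proj (Cay G A))"
proof -
  interpret group G by fact
  interpret Cay: sym_digraph "with_proj (Cay G A)"
    using Cay_undirected(1)[OF assms(2)] .
  show ?thesis
    using assms generate_is_subgroup
    by (simp add: mem_common_lcoset_iff Cay.path_rel_iff_reachable Cay_reachable_iff)
qed

end
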